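(* Let $p$ be a prime, $k\ge2$, and let $\partial_{k+1}$ be the map on $F\otimes_{ku_*}ku_*(\mathbb{Z}_{p^2})$ described in the context. Then: (a) $\partial_{k+1}([1,kg_1+1])=u\,p\,v^{kg_1}[1,1]$ for some unit $u\in ku_*$; (b) there exist an element $x$ of lower filtration than $p[p,(pk+1)g_1+1]$ and a unit $u'\in ku_*$ such that $\partial_{k+1}\big(p[p,(pk+1)g_1+1]+x\big)=u'\,v^{(kp+2)g_1}[1,1]$.
   Context: Fix a prime $p$; $ku_*=\mathbb{Z}_{(p)}[v]$, $v$ of degree 2; $g_1=p-1$. For $m\ge1$, $0\le t\le p^m-1$, let $a_{t,m}=\binom{p^m}{t+1}v^t$. The reduced $ku_*(\mathbb{Z}_{p^2})$ is the $ku_*$-module generated by $e_j$ ($j\ge1$) with relations $\sum_{t=0}^{p^2-1}a_{t,2}e_{j-t}=0$ for all $j\ge1$ ($e_h=0$ for $h\le0$). $F$ is the free $ku_*$-module on $\alpha_i$, $i\ge1$ ($\alpha_h=0$ for $h\le0$); $[i,j]=\alpha_i\otimes e_j\in F\otimes_{ku_*}ku_*(\mathbb{Z}_{p^2})$, zero if $i\le0$ or $j\le0$; $c[i,j]=c\,\alpha_i\otimes e_j$. The $ku_*$-linear map $\partial_{k+1}$ is $\partial_{k+1}([i,j])=\sum_{t=0}^{p^{k+1}-1}a_{t,k+1}[i-t,j]$; its cokernel is $ku_*(\mathbb{Z}_{p^{k+1}})\otimes_{ku_*}ku_*(\mathbb{Z}_{p^2})$. Filtration: $c[i,j]$ has filtration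 $i(p^{k+1}+1)+j(p^k+1)$; an element is of lower filtration than $c[a,b]$ if it is a $ku_*$-linear combination of elements $[i,j]$ of strictly smaller filtration. *)

theory Defs
  imports "HOL-Computational_Algebra.Computational_Algebra"
begin

definition zp :: "nat \<Rightarrow> rat \<Rightarrow> bool" where
  "zp p q \<longleftrightarrow> coprime (snd (quotient_of q)) (int p)"

text \<open>ku_* = Z_(p)[v], realised as rational polynomials in v with Z_(p) coefficients.\<close>
definition ku :: "nat \<Rightarrow> rat poly \<Rightarrow> bool" where
  "ku p f \<longleftrightarrow> (\<forall>n. zp p (coeff f n))"

definition ku_unit :: "nat \<Rightarrow> rat poly \<Rightarrow> bool" where
  "ku_unit p u \<longleftrightarrow> ku p u \<and> (\<exists>w. ku p w \<and> u * w = 1)"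

definition vpow :: "nat \<Rightarrow> rat poly" where
  "vpow t = monom 1 t"

definition acoef :: "nat \<Rightarrow> nat \<Rightarrow> nat \<Rightarrow> rat poly" where
  "acoef p t m = of_nat ((p ^ m) choose (t + 1)) * vpow t"

text \<open>Elements of the free ku_*-module on symbols [i,j] (i,j integers) are functions
  int => int => rat poly; [i,j] = 0 unless i >= 1 and j >= 1.\<close>
type_synonym elt = "int \<Rightarrow> int \<Rightarrow> rat poly"

definition gen :: "int \<Rightarrow> int \<Rightarrow> elt" where
  "gen i j = (\<lambda>a b. if a = i \<and> b = j \<and> i \<ge> 1 \<and> j \<ge> 1 then 1 else 0)"

definition supp :: "elt \<Rightarrow> (int \<times> int) set" where
  "supp x = {(a, b). x a b \<noteq> 0}"

definition valid :: "nat \<Rightarrow> elt \<Rightarrow> bool" where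
  "valid p x \<longleftrightarrow> finite (supp x) \<and> (\<forall>a b. ku p (x a b))
     \<and> (\<forall>(a, b) \<in> supp x. a \<ge> 1 \<and> b \<ge> 1)"

definition scal :: "rat poly \<Rightarrow> elt \<Rightarrow> elt" where
  "scal c x = (\<lambda>a b. c * x a b)"

definition addE :: "elt \<Rightarrow> elt \<Rightarrow> elt" where
  "addE x y = (\<lambda>a b. x a b + y a b)"

text \<open>The relation for index (i,j) coming from ku_*(Z_{p^2}):
  sum_{t=0}^{p^2-1} a_{t,2} [i, j-t].\<close>
definition rel :: "nat \<Rightarrow> int \<Rightarrow> int \<Rightarrow> elt" where
  "rel p i j = (\<lambda>a b. \<Sum>t<p ^ 2. acoef p t 2 * gen i (j - int t) a b)"

text \<open>Equality in F \<otimes> ku_*(Z_{p^2}): the difference is a ku_*-linear combination of relations.\<close>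
definition eqv :: "nat \<Rightarrow> elt \<Rightarrow> elt \<Rightarrow> bool" where
  "eqv p x y \<longleftrightarrow> (\<exists>c. valid p c \<and>
     (\<forall>a b. x a b - y a b = (\<Sum>(i, j) \<in> supp c. c i j * rel p i j a b)))"

text \<open>The map partial_{k+1}([i,j]) = sum_{t=0}^{p^{k+1}-1} a_{t,k+1} [i-t, j], extended linearly.\<close>
definition dmap :: "nat \<Rightarrow> nat \<Rightarrow> elt \<Rightarrow> elt" where
  "dmap p k x = (\<lambda>a b. if a \<ge> 1 \<and> b \<ge> 1 then
      (\<Sum>t<p ^ (k + 1). acoef p t (k + 1) * x (a + int t) b) else 0)"

definition filt :: "nat \<Rightarrow> nat \<Rightarrow> int \<Rightarrow> int \<Rightarrow> int" where
  "filt p k i j = i * (int p ^ (k + 1) + 1) + j * (int p ^ k + 1)"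

definition lower_filt :: "nat \<Rightarrow> nat \<Rightarrow> elt \<Rightarrow> int \<Rightarrow> int \<Rightarrow> bool" where
  "lower_filt p k x a b \<longleftrightarrow> valid p x \<and>
     (\<forall>(i, j) \<in> supp x. filt p k i j < filt p k a b)"

end

theory Submission
  imports Defs
begin

text \<open>
  Let \<open>x\<close> lower the index \<open>j\<close> by one and put \<open>T = v x\<close>, \<open>g = p - 1\<close>. In a fixed total degree everything
  becomes a computation with integer polynomials in \<open>T\<close>: the elements supported on \<open>[a, j]\<close> with \<open>j \<le> n\<close>
  are \<open>\<int>[T]\<close> modulo \<open>T\<^sup>n\<close> and \<open>F (p\<^sup>2)\<close>, where \<open>F n = ((1 + T)\<^sup>n - 1) / T\<close>.
  Now \<open>F (p\<^sup>2) = F p * H\<close> with \<open>F p = p V + T^g\<close> and \<open>H = p U + T^(p g)\<close>, where \<open>V\<close> and \<open>U\<close> have constant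
  term 1. Hence \<open>p V\<close> acts as \<open>- T^g\<close> on multiples of \<open>H\<close>, and \<open>p U\<close> acts as \<open>- T^(p g)\<close> on multiples
  of \<open>F p\<close>. The first fact gives (a). For (b) take the row \<open>U^(k+1) F p\<close> in position \<open>p\<close>: it is killed by
  \<open>p^(k+1)\<close>, so only the coefficient \<open>p^(k+1) choose p = c p^k\<close> contributes, in row 1, where it gives the
  desired unit multiple plus a multiple of \<open>p\<close>, which lies in the image of \<open>p^(k+1)\<close> and is cancelled by
  the row \<open>c T^(k g\<^sup>2) V^(k+2) H\<close> in position 1.
\<close>

section \<open>The polynomials \<open>((1 + T)\<^sup>n - 1) / T\<close>\<close>

definition T :: "int poly" where "T = [:0, 1:]"

text \<open>For \<open>n = p ^ m\<close> these are the coefficients of \<open>acoef p t m\<close>,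
  with \<open>T ^ t\<close> standing for \<open>v ^ t\<close> together with the lowering of an index
  by \<open>t\<close>.\<close>

definition F :: "nat \<Rightarrow> int poly" where
  "F n = (\<Sum>t<n. monom (int (n choose Suc t)) t)"

lemma T_power: "T ^ n = monom 1 n"
  by (simp add: T_def monom_altdef)

lemma monom_of_nat: "monom (int c) n = of_nat c * T ^ n"
  by (simp add: T_power of_nat_poly smult_monom)

lemma monom_sign_of_nat: "monom ((-1) ^ k * int c) n = (-1) ^ k * of_nat c * T ^ n"
  by (simp add: monom_of_nat[symmetric] minus_one_power_iff minus_monom)

lemma T_neq_0 [simp]: "T \<noteq> 0"
  by (simp add: T_def)

lemma coeff_T_power_mult: "coeff (T ^ n * P) i = (if i < n then 0 else coeff P (i - n))"
  by (simp add: T_power coeff_monom_mult)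

lemma poly_T [simp]: "poly T x = x"
  by (simp add: T_def)

lemma pcompose_T [simp]: "pcompose T A = A"
  by (simp add: T_def pcompose_pCons)

lemma pcompose_power: "pcompose (P ^ n) Q = pcompose P Q ^ n" for P Q :: "int poly"
  by (induction n) (simp_all add: pcompose_mult pcompose_1)

lemma T_mult_F: "T * F n = (1 + T) ^ n - 1"
proof -
  have "(1 + T) ^ n = (\<Sum>i\<le>n. of_nat (n choose i) * T ^ i)"
    using binomial_ring[of T 1 n] by (simp add: add.commute)
  also have "\<dots> = 1 + (\<Sum>t<n. of_nat (n choose Suc t) * T ^ Suc t)"
    by (simp add: sum.atMost_shift)
  also have "(\<Sum>t<n. of_nat (n choose Suc t) * T ^ Suc t) = T * F n"
    unfolding F_def sum_distrib_left
  proof (intro sum.cong refl)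
    fix t
    have "of_nat (n choose Suc t) * T ^ Suc t = T * (of_nat (n choose Suc t) * T ^ t)"
      by (simp add: algebra_simps)
    thus "of_nat (n choose Suc t) * T ^ Suc t = T * monom (int (n choose Suc t)) t"
      by (simp only: T_power) (simp add: of_nat_poly smult_monom)
  qed
  finally show ?thesis by simp
qed

text \<open>With \<open>A = (1 + T) ^ p - 1 = T * F p\<close>, both \<open>T * F (p ^ 2)\<close> and
  \<open>A * pcompose (F p) A\<close> equal \<open>(1 + A) ^ p - 1\<close>; then \<open>T\<close> is
  cancelled.\<close>

lemma F_square: "F (p ^ 2) = F p * pcompose (F p) ((1 + T) ^ p - 1)"
proof -
  define A where "A = (1 + T) ^ p - 1"
  have "pcompose (T * F p) A = pcompose ((1 + T) ^ p - 1) A"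
    by (simp only: T_mult_F)
  hence "A * pcompose (F p) A = (1 + A) ^ p - 1"
    by (simp add: pcompose_mult pcompose_diff pcompose_power pcompose_add pcompose_1)
  also have "\<dots> = T * F (p ^ 2)"
    by (simp add: A_def T_mult_F power2_eq_square power_mult)
  finally have "T * F (p ^ 2) = T * (F p * pcompose (F p) A)"
    by (simp add: A_def T_mult_F[symmetric] mult.assoc)
  thus ?thesis
    by (simp add: A_def)
qed

lemma F_prime:
  assumes "prime p"
  obtains V where "F p = of_nat p * V + T ^ (p - 1)" "poly V 0 = 1"
proof -
  define V where "V = (\<Sum>t<p - 1. monom (int ((p choose Suc t) div p)) t)"
  have p: "p \<ge> 2" using assms by (rule prime_ge_2_nat)
  have eq: "monom (int (p choose Suc t)) t = of_nat p * monom (int ((p choose Suc t) div p)) t"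
    if "t < p - 1" for t
  proof -
    have "p dvd p choose Suc t"
      using that assms by (intro dvd_choose_prime) auto
    hence "int (p choose Suc t) = int p * int ((p choose Suc t) div p)"
      by (metis dvd_mult_div_cancel of_nat_mult)
    thus ?thesis by (simp add: of_nat_poly smult_monom)
  qed
  have "F p = (\<Sum>t<Suc (p - 1). monom (int (p choose Suc t)) t)"
    using p by (simp add: F_def)
  also have "\<dots> = of_nat p * V + monom (int (p choose Suc (p - 1))) (p - 1)"
    by (simp only: sum.lessThan_Suc V_def sum_distrib_left) (simp add: eq)
  also have "\<dots> = of_nat p * V + T ^ (p - 1)"
    using p by (simp add: T_power)
  finally have "F p = of_nat p * V + T ^ (p - 1)" .
  moreover have "poly V 0 = 1"
  proof -
    have "poly V 0 = (\<Sum>t<p - 1. if t = 0 then int ((p choose Suc t) div p) else 0)"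
      unfolding V_def poly_sum by (intro sum.cong) (auto simp: poly_monom)
    thus ?thesis using p by (simp add: sum.delta)
  qed
  ultimately show thesis by (rule that)
qed

lemma F_square_prime:
  assumes "prime p"
  obtains V U H where
    "F p = of_nat p * V + T ^ (p - 1)" "poly V 0 = 1"
    "H = of_nat p * U + T ^ (p * (p - 1))" "poly U 0 = 1"
    "F (p ^ 2) = F p * H"
proof -
  obtain V where V: "F p = of_nat p * V + T ^ (p - 1)" "poly V 0 = 1"
    using F_prime[OF assms] .
  define A where "A = (1 + T) ^ p - 1"
  have A: "A = T * F p" by (simp add: A_def T_mult_F)
  have "A - T ^ p = of_nat p * V * T"
    using prime_gt_0_nat[OF assms] unfolding A V(1) by (simp add: algebra_simps power_eq_if)
  moreover obtain Q where "A ^ (p - 1) - (T ^ p) ^ (p - 1) = (A - T ^ p) * Q"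
    using power_diff_sumr2 by blast
  ultimately have Q: "A ^ (p - 1) = of_nat p * V * T * Q + T ^ (p * (p - 1))"
    by (simp add: power_mult diff_eq_eq add.commute \<open>A - T ^ p = _\<close>)
  \<comment> \<open>Modulo \<open>p\<close>, \<open>A\<close> is \<open>T ^ p\<close>, so the power
    \<open>A ^ (p - 1)\<close> in \<open>pcompose (F p) A\<close> becomes
    \<open>T ^ (p * (p - 1))\<close>. The error goes into \<open>U\<close> and, having a factor
    \<open>T\<close>, leaves its constant term alone.\<close>
  define U where "U = pcompose V A + V * T * Q"
  have "pcompose (F p) A = of_nat p * pcompose V A + A ^ (p - 1)"
    by (simp add: V(1) pcompose_mult pcompose_add pcompose_power
        of_nat_poly pcompose_smult pcompose_const)
  hence "pcompose (F p) A = of_nat p * U + T ^ (p * (p - 1))"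
    by (simp only: Q U_def algebra_simps)
  moreover have "poly U 0 = 1"
    by (simp add: U_def poly_pcompose A V)
  ultimately show thesis
    using V F_square[of p] that[of V "pcompose (F p) A" U] by (simp add: A_def)
qed

lemma poly_0_eq_1E:
  assumes "poly W 0 = (1 :: int)"
  obtains Y where "W = 1 + T * Y"
proof -
  have "[:- 0, 1:] dvd W - 1"
    using assms by (subst poly_eq_0_iff_dvd[symmetric]) simp
  then obtain Y where "W - 1 = T * Y"
    by (auto simp: T_def elim: dvdE)
  thus thesis by (intro that[of Y]) (simp add: algebra_simps)
qed

section \<open>The ideal generated by \<open>F (p\<^sup>2)\<close> and \<open>T\<^sup>n\<close>\<close>

text \<open>Row \<open>a\<close> in total degree \<open>D\<close> uses \<open>n = D - a\<close>:
  \<open>F (p ^ 2)\<close> is the relation in the second index, and \<open>T ^ n\<close> lowers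
  every \<open>[a, j]\<close> with \<open>j \<le> n\<close> to zero.\<close>

definition ideal2 :: "nat \<Rightarrow> nat \<Rightarrow> int poly set" where
  "ideal2 p n = {F (p ^ 2) * R + T ^ n * S | R S. True}"

lemma ideal2I: "P = F (p ^ 2) * R + T ^ n * S \<Longrightarrow> P \<in> ideal2 p n"
  by (auto simp: ideal2_def)

lemma ideal2E:
  assumes "P \<in> ideal2 p n"
  obtains R S where "P = F (p ^ 2) * R + T ^ n * S"
  using assms by (auto simp: ideal2_def)

lemma ideal2_add: "P \<in> ideal2 p n \<Longrightarrow> Q \<in> ideal2 p n \<Longrightarrow> P + Q \<in> ideal2 p n"
proof (elim ideal2E)
  fix R S R' S' assume "P = F (p ^ 2) * R + T ^ n * S" "Q = F (p ^ 2) * R' + T ^ n * S'"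
  thus "P + Q \<in> ideal2 p n"
    by (intro ideal2I[of _ _ "R + R'" _ "S + S'"]) (simp add: algebra_simps)
qed

lemma ideal2_mult: "P \<in> ideal2 p n \<Longrightarrow> Q * P \<in> ideal2 p n"
proof (elim ideal2E)
  fix R S assume "P = F (p ^ 2) * R + T ^ n * S"
  thus "Q * P \<in> ideal2 p n"
    by (intro ideal2I[of _ _ "Q * R" _ "Q * S"]) (simp add: algebra_simps)
qed

lemma ideal2_diff: "P \<in> ideal2 p n \<Longrightarrow> Q \<in> ideal2 p n \<Longrightarrow> P - Q \<in> ideal2 p n"
  using ideal2_add[of P p n "-1 * Q"] ideal2_mult[of Q p n "-1"] by simp

lemma F_in_ideal2: "F (p ^ 2) * R \<in> ideal2 p n"
  by (rule ideal2I[of _ _ R _ 0]) simp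

lemma T_power_in_ideal2: "n \<le> m \<Longrightarrow> T ^ m * S \<in> ideal2 p n"
  by (rule ideal2I[of _ _ 0 _ "T ^ (m - n) * S"]) (simp add: mult.assoc[symmetric] flip: power_add)

lemma ideal2_T_mult:
  assumes "P \<in> ideal2 p n" "m \<le> l + n"
  shows "T ^ l * P \<in> ideal2 p m"
proof -
  obtain R S where "P = F (p ^ 2) * R + T ^ n * S"
    using assms(1) by (rule ideal2E)
  hence "T ^ l * P = F (p ^ 2) * (T ^ l * R) + T ^ (l + n) * S"
    by (simp add: power_add algebra_simps)
  thus ?thesis
    using F_in_ideal2 T_power_in_ideal2[OF assms(2)] ideal2_add by metis
qed

text \<open>A polynomial with constant term 1 is a unit modulo \<open>T\<^sup>n\<close>.\<close>
lemma ideal2_cancel: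
  assumes "P * W \<in> ideal2 p n" "poly W 0 = 1"
  shows "P \<in> ideal2 p n"
proof -
  obtain Y where Y: "W = 1 + T * Y"
    using assms(2) by (rule poly_0_eq_1E)
  obtain Q where Q: "1 ^ n - (1 - W) ^ n = (1 - (1 - W)) * Q"
    using power_diff_sumr2 by blast
  have "P = Q * (P * W) + P * (1 - W) ^ n"
  proof -
    have *: "(1 - W) ^ n = 1 - W * Q" using Q by (simp add: algebra_simps)
    show ?thesis unfolding * by (simp add: algebra_simps)
  qed
  also have "(1 - W) ^ n = T ^ n * (- Y) ^ n"
    by (simp add: Y flip: power_mult_distrib)
  finally have "P = Q * (P * W) + T ^ n * ((- Y) ^ n * P)"
    by (simp add: algebra_simps)
  thus ?thesis
    using ideal2_add[OF ideal2_mult[OF assms(1)] T_power_in_ideal2[OF order_refl]] by metis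
qed

text \<open>If \<open>A * B\<close> vanishes, then \<open>A\<close> acts as zero on multiples of \<open>B\<close>, so \<open>A - C\<close> acts as \<open>- C\<close>.\<close>
lemma power_mult_in_ideal2:
  assumes "F (p ^ 2) = A * B"
  shows "(A - C) ^ n * B - (- C) ^ n * B \<in> ideal2 p m"
proof -
  obtain Q where "(A - C) ^ n - (- C) ^ n = (A - C - - C) * Q"
    using power_diff_sumr2 by blast
  hence "(A - C) ^ n * B - (- C) ^ n * B = F (p ^ 2) * Q"
    by (simp add: assms algebra_simps flip: left_diff_distrib)
  thus ?thesis by (simp add: F_in_ideal2)
qed


section \<open>Powers of \<open>p\<close> modulo the ideal\<close>

locale F_square_factors =
  fixes p :: nat and V U H :: "int poly"
  assumes prime: "prime p"
    and F_p: "F p = of_nat p * V + T ^ (p - 1)" and V_0: "poly V 0 = 1"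
    and H: "H = of_nat p * U + T ^ (p * (p - 1))" and U_0: "poly U 0 = 1"
    and F_p2: "F (p ^ 2) = F p * H"
begin

lemma p_ge_2: "p \<ge> 2"
  using prime by (rule prime_ge_2_nat)

lemma pV_power_H: "of_nat p ^ n * V ^ n * H - (-1) ^ n * T ^ (n * (p - 1)) * H \<in> ideal2 p m"
proof -
  have "(- (T ^ (p - 1))) ^ n = (-1) ^ n * T ^ (n * (p - 1))"
    by (subst power_minus) (simp add: mult.commute flip: power_mult)
  thus ?thesis
    using power_mult_in_ideal2[OF F_p2, of "T ^ (p - 1)" n m]
    by (simp add: F_p power_mult_distrib)
qed

lemma pU_power_F: "of_nat p ^ n * U ^ n * F p - (-1) ^ n * T ^ (n * p * (p - 1)) * F p \<in> ideal2 p m"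
proof -
  have "(- (T ^ (p * (p - 1)))) ^ n = (-1) ^ n * T ^ (n * p * (p - 1))"
    by (subst power_minus) (simp add: mult_ac flip: power_mult)
  thus ?thesis
    using power_mult_in_ideal2[of p H "F p" "T ^ (p * (p - 1))" n m]
    by (simp add: F_p2 mult.commute H power_mult_distrib)
qed

text \<open>In the induction step, multiply by \<open>V ^ Suc n * U\<close> and write
  \<open>p U\<close> as \<open>H - T ^ (p * (p - 1))\<close>. The \<open>H\<close> term becomes a
  multiple of \<open>T ^ (Suc n * (p - 1))\<close>, the other is covered by the induction
  hypothesis, and the multiplier cancels.\<close>

lemma p_power_in_ideal2: "of_nat p ^ Suc n \<in> ideal2 p (n * (p - 1))"
proof (induction n)
  case 0
  show ?case by (rule ideal2I[of _ _ 0 _ "of_nat p"]) simp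
next
  case (Suc n)
  let ?k = "Suc n"
  have 1: "of_nat p ^ ?k * V ^ ?k * H - (-1) ^ ?k * T ^ (?k * (p - 1)) * H \<in> ideal2 p (?k * (p - 1))"
    by (rule pV_power_H)
  have 2: "V ^ ?k * (T ^ (p * (p - 1)) * of_nat p ^ ?k) \<in> ideal2 p (?k * (p - 1))"
  proof (intro ideal2_mult[OF ideal2_T_mult[OF Suc.IH]])
    have "1 * (p - 1) \<le> p * (p - 1)"
      using p_ge_2 by (intro mult_right_mono) auto
    thus "?k * (p - 1) \<le> p * (p - 1) + n * (p - 1)"
      by (simp only: mult_Suc)
  qed
  have 3: "T ^ (?k * (p - 1)) * ((-1) ^ ?k * H) \<in> ideal2 p (?k * (p - 1))"
    by (rule T_power_in_ideal2) simp
  have "of_nat p ^ Suc ?k * (V ^ ?k * U) =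
      of_nat p ^ ?k * V ^ ?k * H - V ^ ?k * (T ^ (p * (p - 1)) * of_nat p ^ ?k)"
    unfolding H by (simp add: algebra_simps)
  also have "\<dots> = (of_nat p ^ ?k * V ^ ?k * H - (-1) ^ ?k * T ^ (?k * (p - 1)) * H)
      - V ^ ?k * (T ^ (p * (p - 1)) * of_nat p ^ ?k) + T ^ (?k * (p - 1)) * ((-1) ^ ?k * H)"
    by (simp add: algebra_simps)
  also have "\<dots> \<in> ideal2 p (?k * (p - 1))"
    by (intro ideal2_add ideal2_diff 1 2 3)
  finally show ?case
    by (rule ideal2_cancel) (simp add: V_0 U_0 poly_mult)
qed

text \<open>The same computation to one more order, as (a) requires. As \<open>p ^ Suc n\<close> has
  order \<open>n * (p - 1)\<close> already, \<open>V ^ n * U\<close> may be replaced by 1, and next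
  to \<open>T ^ (n * (p - 1))\<close> only the constant term \<open>p\<close> of \<open>H\<close>
  survives.\<close>

lemma p_power_cong:
  "of_nat p ^ Suc n - (-1) ^ n * of_nat p * T ^ (n * (p - 1)) \<in> ideal2 p (n * (p - 1) + 1)"
proof (cases n)
  case 0
  thus ?thesis by (intro ideal2I[of _ _ 0 _ 0]) simp
next
  case (Suc m)
  let ?I = "ideal2 p (n * (p - 1) + 1)"
  obtain Y where Y: "V ^ n * U = 1 + T * Y"
    by (rule poly_0_eq_1E[of "V ^ n * U"]) (simp add: V_0 U_0)
  obtain Z where Z: "U = 1 + T * Z"
    using U_0 by (rule poly_0_eq_1E)
  have 1: "of_nat p ^ n * V ^ n * H - (-1) ^ n * T ^ (n * (p - 1)) * H \<in> ?I"
    by (rule pV_power_H)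
  \<comment> \<open>With \<open>n = Suc m\<close>, the bound below amounts to
    \<open>1 \<le> (p - 1) * (p - 1)\<close>.\<close>
  have "1 * (p - 1) \<le> (p - 1) * (p - 1)"
    using p_ge_2 by (intro mult_right_mono) auto
  hence le: "n * (p - 1) + 1 \<le> p * (p - 1) + m * (p - 1)"
    using p_ge_2 by (cases p) (auto simp: Suc)
  have 2: "V ^ n * (T ^ (p * (p - 1)) * of_nat p ^ n) \<in> ?I"
    using ideal2_T_mult[OF p_power_in_ideal2[of m] le] by (auto simp: Suc intro: ideal2_mult)
  have 3: "Y * (T ^ 1 * of_nat p ^ Suc n) \<in> ?I"
    by (intro ideal2_mult[OF ideal2_T_mult[OF p_power_in_ideal2[of n]]]) simp
  have 4: "T ^ (n * (p - 1) + 1) * ((-1) ^ n * of_nat p * Z) \<in> ?I"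
    by (rule T_power_in_ideal2) simp
  have 5: "T ^ (n * (p - 1) + p * (p - 1)) * (-1) ^ n \<in> ?I"
    using p_ge_2 by (intro T_power_in_ideal2) (simp add: Suc_le_eq)
  have "of_nat p ^ Suc n - (-1) ^ n * of_nat p * T ^ (n * (p - 1)) =
      (of_nat p ^ n * V ^ n * H - (-1) ^ n * T ^ (n * (p - 1)) * H)
      - V ^ n * (T ^ (p * (p - 1)) * of_nat p ^ n) - Y * (T ^ 1 * of_nat p ^ Suc n)
      + T ^ (n * (p - 1) + 1) * ((-1) ^ n * of_nat p * Z)
      + T ^ (n * (p - 1) + p * (p - 1)) * (-1) ^ n"
  proof -
    have "of_nat p ^ Suc n = of_nat p ^ Suc n * (V ^ n * U) - Y * (T ^ 1 * of_nat p ^ Suc n)"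
      unfolding Y by (simp add: algebra_simps)
    also have "of_nat p ^ Suc n * (V ^ n * U) =
        of_nat p ^ n * V ^ n * H - V ^ n * (T ^ (p * (p - 1)) * of_nat p ^ n)"
      unfolding H by (simp add: algebra_simps)
    finally have *: "of_nat p ^ Suc n = of_nat p ^ n * V ^ n * H
        - V ^ n * (T ^ (p * (p - 1)) * of_nat p ^ n) - Y * (T ^ 1 * of_nat p ^ Suc n)" .
    have "T ^ (n * (p - 1)) * H = of_nat p * T ^ (n * (p - 1))
        + T ^ (n * (p - 1) + 1) * (of_nat p * Z) + T ^ (n * (p - 1) + p * (p - 1))"
      unfolding H Z power_add by (simp add: distrib_left distrib_right mult_ac)
    hence "(-1) ^ n * T ^ (n * (p - 1)) * H = (-1) ^ n * of_nat p * T ^ (n * (p - 1))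
        + T ^ (n * (p - 1) + 1) * ((-1) ^ n * of_nat p * Z)
        + T ^ (n * (p - 1) + p * (p - 1)) * (-1) ^ n"
      by (simp only: mult.assoc distrib_left) (simp only: mult_ac)
    thus ?thesis by (subst *) (simp only: algebra_simps)
  qed
  also have "\<dots> \<in> ?I"
    by (intro ideal2_add ideal2_diff 1 2 3 4 5)
  finally show ?thesis .
qed

text \<open>For \<open>n = Suc k\<close> this makes the image of the row
  \<open>U ^ Suc k * F p\<close> vanish in rows 2 to \<open>p\<close>.\<close>

lemma pU_power_F_in_ideal2:
  assumes "m \<le> n * p * (p - 1)"
  shows "of_nat p ^ n * U ^ n * F p \<in> ideal2 p m"
  using ideal2_add[OF pU_power_F[of n m] T_power_in_ideal2[OF assms, of "(-1) ^ n * F p"]]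
  by (simp add: algebra_simps)

text \<open>Up to the sign \<open>(-1) ^ k\<close>, the two summands act as
  \<open>M * U * F p\<close> and \<open>- M * V * H\<close> with
  \<open>M = T ^ ((k * p + 1) * (p - 1))\<close>. In \<open>U * F p - V * H\<close> the terms
  \<open>p U V\<close> cancel, leaving \<open>T ^ (p - 1)\<close> to lowest order.\<close>

lemma row_one_cong:
  "of_nat p ^ k * T ^ (p - 1) * U ^ Suc k * F p
    + of_nat p ^ Suc k * T ^ (k * (p - 1) * (p - 1)) * V ^ (k + 2) * H
    - (-1) ^ k * T ^ ((k * p + 2) * (p - 1)) \<in> ideal2 p ((k * p + 2) * (p - 1) + 1)"
proof -
  let ?I = "ideal2 p ((k * p + 2) * (p - 1) + 1)" and ?M = "T ^ ((k * p + 1) * (p - 1))"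
  let ?N = "T ^ (k * (p - 1) * (p - 1))" and ?s = "(-1) ^ k :: int poly"
  obtain Z where Z: "U = 1 + T * Z"
    using U_0 by (rule poly_0_eq_1E)
  \<comment> \<open>The exponent \<open>k * (p - 1) * (p - 1)\<close> is chosen so that both
    summands carry the same power \<open>M\<close>.\<close>
  have M1: "?N * T ^ (Suc k * (p - 1)) = ?M"
    using p_ge_2 by (cases p) (simp_all flip: power_add add: algebra_simps)
  have M2: "T ^ (p - 1) * T ^ (k * p * (p - 1)) = ?M"
    by (simp flip: power_add add: algebra_simps)
  have M3: "T ^ ((k * p + 2) * (p - 1)) = ?M * T ^ (p - 1)"
    by (simp flip: power_add add: algebra_simps)
  have 1: "T ^ (p - 1) * U * (of_nat p ^ k * U ^ k * F p - ?s * T ^ (k * p * (p - 1)) * F p) \<in> ?I"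
    by (intro ideal2_mult pU_power_F)
  have 2: "?N * V * (of_nat p ^ Suc k * V ^ Suc k * H
      - (-1) ^ Suc k * T ^ (Suc k * (p - 1)) * H) \<in> ?I"
    by (intro ideal2_mult pV_power_H)
  have 3: "T ^ ((k * p + 2) * (p - 1) + 1) * (?s * Z) \<in> ?I"
    by (rule T_power_in_ideal2) simp
  have "1 * (p - 1) < p * (p - 1)"
    using p_ge_2 by (intro mult_strict_right_mono) auto
  hence 4: "T ^ ((k * p + 1) * (p - 1) + p * (p - 1)) * (?s * V) \<in> ?I"
    by (intro T_power_in_ideal2) (simp add: algebra_simps)
  have "T ^ (p - 1) * U * (of_nat p ^ k * U ^ k * F p - ?s * T ^ (k * p * (p - 1)) * F p) =
      of_nat p ^ k * T ^ (p - 1) * U ^ Suc k * F p - ?s * ?M * U * F p"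
    unfolding M2[symmetric] by (simp add: algebra_simps)
  moreover have "?N * V * (of_nat p ^ Suc k * V ^ Suc k * H
      - (-1) ^ Suc k * T ^ (Suc k * (p - 1)) * H) =
      of_nat p ^ Suc k * ?N * V ^ (k + 2) * H + ?s * ?M * V * H"
    unfolding M1[symmetric] by (simp add: algebra_simps)
  moreover have "T ^ ((k * p + 2) * (p - 1) + 1) * (?s * Z) = ?s * ?M * (U - 1) * T ^ (p - 1)"
    unfolding Z power_add M3 by (simp add: algebra_simps)
  moreover have "T ^ ((k * p + 1) * (p - 1) + p * (p - 1)) * (?s * V) =
      ?s * ?M * V * T ^ (p * (p - 1))"
    unfolding power_add by (simp add: algebra_simps)
  moreover have "?s * ?M * U * F p - ?s * ?M * V * H =
      ?s * ?M * (U - 1) * T ^ (p - 1) - ?s * ?M * V * T ^ (p * (p - 1)) + ?s * (?M * T ^ (p - 1))"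
    unfolding F_p H by (simp add: algebra_simps)
  ultimately have "of_nat p ^ k * T ^ (p - 1) * U ^ Suc k * F p
      + of_nat p ^ Suc k * ?N * V ^ (k + 2) * H - ?s * T ^ ((k * p + 2) * (p - 1)) =
      T ^ (p - 1) * U * (of_nat p ^ k * U ^ k * F p - ?s * T ^ (k * p * (p - 1)) * F p)
      + ?N * V * (of_nat p ^ Suc k * V ^ Suc k * H - (-1) ^ Suc k * T ^ (Suc k * (p - 1)) * H)
      + T ^ ((k * p + 2) * (p - 1) + 1) * (?s * Z)
      - T ^ ((k * p + 1) * (p - 1) + p * (p - 1)) * (?s * V)"
    unfolding M3 by (simp only: algebra_simps)
  also have "\<dots> \<in> ?I"
    by (intro ideal2_add ideal2_diff 1 2 3 4)
  finally show ?thesis .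
qed

end

section \<open>Binomial coefficients of prime powers\<close>

text \<open>The absorption identity pulls out \<open>p ^ n\<close>, and \<open>m\<close> is prime to
  \<open>p\<close>.\<close>

lemma prime_power_dvd_choose:
  assumes "prime p" "0 < m" "m < p"
  shows "p ^ n dvd p ^ n choose m"
proof -
  have "m * (p ^ n choose m) = p ^ n * ((p ^ n - 1) choose (m - 1))"
    using assms times_binomial_minus1_eq by blast
  hence "p ^ n dvd m * (p ^ n choose m)" by simp
  moreover have "coprime (p ^ n) m"
    using assms by (simp add: prime_imp_coprime_nat nat_dvd_not_less)
  ultimately show ?thesis
    by (simp add: coprime_dvd_mult_right_iff)
qed

text \<open>By Pascal's rule, neighbouring entries of row \<open>p ^ n - 1\<close> sum to a multiple
  of \<open>p\<close>, so non-divisibility propagates from the entry 1 at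
  \<open>m = 0\<close>.\<close>

lemma prime_not_dvd_choose_pred:
  assumes "prime p" "m < p" "n > 0"
  shows "\<not> p dvd (p ^ n - 1) choose m"
  using assms(2)
proof (induction m)
  case 0
  thus ?case using assms(1) by (auto simp: prime_nat_iff)
next
  case (Suc m)
  have "p dvd p ^ n" using assms(3) by simp
  also have "p ^ n dvd p ^ n choose Suc m"
    using assms(1) Suc.prems by (intro prime_power_dvd_choose) auto
  also have "p ^ n choose Suc m = (p ^ n - 1 choose m) + (p ^ n - 1 choose Suc m)"
    using assms(1) prime_gt_0_nat[OF assms(1)] by (cases "p ^ n") auto
  finally show ?case
    using Suc by (meson Suc_lessD dvd_add_left_iff)
qed

lemma prime_power_choose_prime:
  assumes "prime p"
  obtains c where "p ^ Suc k choose p = p ^ k * c" "\<not> p dvd c"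
proof
  have "p * (p ^ Suc k choose p) = p ^ Suc k * ((p ^ Suc k - 1) choose (p - 1))"
    using prime_gt_0_nat[OF assms] times_binomial_minus1_eq by blast
  thus "p ^ Suc k choose p = p ^ k * ((p ^ Suc k - 1) choose (p - 1))"
    using prime_gt_0_nat[OF assms] by (simp add: mult.assoc)
  show "\<not> p dvd (p ^ Suc k - 1) choose (p - 1)"
    using assms prime_gt_0_nat[OF assms] by (intro prime_not_dvd_choose_pred) auto
qed


section \<open>Homogeneous elements\<close>

lemma zp_of_int_divide:
  assumes "coprime b (int p)" "b \<noteq> 0"
  shows "zp p (of_int a / of_int b)"
proof -
  obtain n d where nd: "quotient_of (of_int a / of_int b) = (n, d)"
    by fastforce
  have "of_int a / of_int b = (of_int n / of_int d :: rat)" and d: "d > 0" and co: "coprime n d"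
    using nd quotient_of_div quotient_of_denom_pos quotient_of_coprime by blast+
  hence "of_int (a * d) = (of_int (n * b) :: rat)"
    using assms(2) by (simp add: field_simps)
  hence "a * d = n * b"
    by (simp only: of_int_eq_iff)
  hence "d dvd b"
    using co by (metis coprime_commute coprime_dvd_mult_right_iff dvd_triv_right)
  thus ?thesis
    using assms(1) nd by (simp add: zp_def) (meson coprime_divisors dvd_refl)
qed

lemma ku_monom_of_int [simp]: "ku p (monom (of_int a) n)"
  by (auto simp: ku_def coeff_monom) (simp_all add: zp_def)

lemma ku_unit_of_int:
  assumes "coprime c (int p)" "c \<noteq> 0"
  shows "ku_unit p [:of_int c:]"
proof -
  have "ku p [:of_int c:]" "ku p [:1 / of_int c:]"
    using zp_of_int_divide[OF assms, of 1] by (auto simp: ku_def coeff_pCons zp_def split: nat.splits)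
  moreover have "[:of_int c:] * [:1 / of_int c:] = (1 :: rat poly)"
    using assms(2) by simp
  ultimately show ?thesis
    unfolding ku_unit_def by blast
qed

text \<open>Row \<open>a\<close> is \<open>Q a\<close> applied to \<open>[a, D - a]\<close>; the fixed total degree \<open>D\<close> determines the powers of \<open>v\<close>.\<close>
definition hom :: "int \<Rightarrow> (int \<Rightarrow> int poly) \<Rightarrow> elt" where
  "hom D Q = (\<lambda>a b. if a \<ge> 1 \<and> b \<ge> 1 \<and> a + b \<le> D
     then monom (of_int (coeff (Q a) (nat (D - a - b)))) (nat (D - a - b)) else 0)"

lemma valid_hom: "valid p (hom D Q)"
proof -
  have "supp (hom D Q) \<subseteq> {1..D} \<times> {1..D}"
    by (auto simp: supp_def hom_def split: if_splits)
  hence "finite (supp (hom D Q))"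
    by (rule finite_subset) simp
  moreover have "ku p 0"
    using ku_monom_of_int[of p 0 0] by simp
  ultimately show ?thesis
    by (auto simp: valid_def supp_def hom_def split: if_splits)
qed

lemma hom_gen:
  assumes "i \<ge> 1" "j \<ge> 1"
  shows "scal ([:of_int c:] * vpow s) (gen i j) = hom (i + j + int s) (\<lambda>a. if a = i then monom c s else 0)"
  using assms by (auto simp: fun_eq_iff scal_def gen_def hom_def vpow_def smult_monom)

lemma hom_add: "addE (hom D Q) (hom D R) = hom D (\<lambda>a. Q a + R a)"
  by (auto simp: fun_eq_iff addE_def hom_def add_monom)

text \<open>The coefficient at \<open>[a, b]\<close> belongs to \<open>T ^ n\<close> with
  \<open>n = D - a - b\<close>, so the sum is the convolution defining a product of
  polynomials.\<close>

lemma sum_acoef_hom: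
  assumes "a \<ge> 1" "b \<ge> 1"
  shows "(\<Sum>t<p ^ m. acoef p t m * hom D Q a (b + int t)) = hom D (\<lambda>a. F (p ^ m) * Q a) a b"
proof (cases "a + b \<le> D")
  case False
  thus ?thesis by (simp add: hom_def)
next
  case True
  define n where "n = nat (D - a - b)"
  have D: "D = a + b + int n" using True by (simp add: n_def)
  have "acoef p t m * hom D Q a (b + int t) =
      monom (of_int (coeff (monom (int (p ^ m choose Suc t)) t * Q a) n)) n" for t
  proof (cases "t \<le> n")
    case True
    hence "nat (int n - int t) = n - t" by simp
    thus ?thesis
      using assms True
      by (simp add: hom_def D acoef_def vpow_def coeff_monom_mult of_nat_poly smult_monom mult_monom)
  next
    case False
    thus ?thesis
      using assms by (simp add: hom_def D coeff_monom_mult)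
  qed
  hence "(\<Sum>t<p ^ m. acoef p t m * hom D Q a (b + int t)) =
      monom (of_int (coeff (F (p ^ m) * Q a) n)) n"
    by (simp add: F_def sum_distrib_right coeff_sum monom_sum)
  thus ?thesis
    using assms by (simp add: hom_def D)
qed


text \<open>Collects the contributions to \<open>[a, b]\<close>: they come from the relations at
  \<open>(a, b + t)\<close>. This is the form to which \<open>sum_acoef_hom\<close> applies.\<close>

lemma sum_supp_rel:
  assumes "valid p c"
  shows "(\<Sum>(i, j)\<in>supp c. c i j * rel p i j a b) =
    (if a \<ge> 1 \<and> b \<ge> 1 then \<Sum>t<p ^ 2. acoef p t 2 * c a (b + int t) else 0)"
proof -
  have fin: "finite (supp c)" using assms by (simp add: valid_def)
  have "(\<Sum>(i, j)\<in>supp c. c i j * rel p i j a b) =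
      (\<Sum>ij\<in>supp c. \<Sum>t<p ^ 2. acoef p t 2 * (c (fst ij) (snd ij) * gen (fst ij) (snd ij - int t) a b))"
    by (simp add: rel_def sum_distrib_left case_prod_unfold mult_ac)
  also have "\<dots> = (\<Sum>t<p ^ 2. acoef p t 2 *
      (\<Sum>ij\<in>supp c. c (fst ij) (snd ij) * gen (fst ij) (snd ij - int t) a b))"
    by (subst sum.swap) (simp add: sum_distrib_left)
  finally have sum_eq: "(\<Sum>(i, j)\<in>supp c. c i j * rel p i j a b) = (\<Sum>t<p ^ 2. acoef p t 2 *
      (\<Sum>ij\<in>supp c. c (fst ij) (snd ij) * gen (fst ij) (snd ij - int t) a b))" .
  have "(\<Sum>ij\<in>supp c. c (fst ij) (snd ij) * gen (fst ij) (snd ij - int t) a b) =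
      (if a \<ge> 1 \<and> b \<ge> 1 then c a (b + int t) else 0)" for t
  proof -
    have "(\<Sum>ij\<in>supp c. c (fst ij) (snd ij) * gen (fst ij) (snd ij - int t) a b) =
        (\<Sum>ij\<in>supp c. if ij = (a, b + int t) then (if a \<ge> 1 \<and> b \<ge> 1 then c a (b + int t) else 0) else 0)"
      by (intro sum.cong) (auto simp: gen_def)
    thus ?thesis using fin by (auto simp: sum.delta supp_def)
  qed
  thus ?thesis unfolding sum_eq by auto
qed

text \<open>The cofactors of \<open>F (p ^ 2)\<close> in the rows, assembled into
  \<open>hom D R\<close>, are the required coefficients of the relations. The multiples of
  \<open>T ^ (D - a)\<close> contribute nothing, since \<open>b \<ge> 1\<close> reads off only lower
  powers.\<close>

lemma eqv_hom:
  assumes "\<And>a. 1 \<le> a \<Longrightarrow> a < D \<Longrightarrow> Q a - Q' a \<in> ideal2 p (nat (D - a))"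
  shows "eqv p (hom D Q) (hom D Q')"
proof -
  have "\<exists>R. \<exists>S. 1 \<le> a \<longrightarrow> a < D \<longrightarrow> Q a - Q' a = F (p ^ 2) * R + T ^ nat (D - a) * S" for a
    using assms[of a] by (auto simp: ideal2_def)
  then obtain R where R:
    "\<And>a. 1 \<le> a \<Longrightarrow> a < D \<Longrightarrow> \<exists>S. Q a - Q' a = F (p ^ 2) * R a + T ^ nat (D - a) * S"
    by metis
  have "hom D Q a b - hom D Q' a b = hom D (\<lambda>a. F (p ^ 2) * R a) a b" if ab: "a \<ge> 1" "b \<ge> 1" for a b
  proof (cases "a + b \<le> D")
    case True
    then obtain S where S: "Q a - Q' a = F (p ^ 2) * R a + T ^ nat (D - a) * S"
      using R[of a] ab by auto
    have "coeff (Q a - Q' a) (nat (D - a - b)) = coeff (F (p ^ 2) * R a) (nat (D - a - b))"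
      unfolding S using ab True by (simp add: coeff_T_power_mult)
    thus ?thesis
      using ab True by (simp add: hom_def diff_monom flip: of_int_diff)
  qed (simp add: hom_def)
  hence "hom D Q a b - hom D Q' a b = (\<Sum>(i, j)\<in>supp (hom D R). hom D R i j * rel p i j a b)" for a b
    by (subst sum_supp_rel[OF valid_hom]) (auto simp: sum_acoef_hom, auto simp: hom_def)
  thus ?thesis
    unfolding eqv_def using valid_hom by blast
qed

text \<open>Passing from row \<open>a + t\<close> to row \<open>a\<close> in fixed total degree
  costs \<open>v ^ t\<close>, hence the factor \<open>T ^ t\<close>.\<close>

lemma dmap_hom:
  "dmap p k (hom D Q) =
     hom D (\<lambda>a. \<Sum>t<p ^ Suc k. monom (int (p ^ Suc k choose Suc t)) t * Q (a + int t))"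
proof (intro ext)
  fix a b
  show "dmap p k (hom D Q) a b =
    hom D (\<lambda>a. \<Sum>t<p ^ Suc k. monom (int (p ^ Suc k choose Suc t)) t * Q (a + int t)) a b"
  proof (cases "a \<ge> 1 \<and> b \<ge> 1 \<and> a + b \<le> D")
    case False
    thus ?thesis by (auto simp: dmap_def hom_def)
  next
    case True
    define n where "n = nat (D - a - b)"
    have D: "D = a + b + int n" using True by (simp add: n_def)
    have "acoef p t (Suc k) * hom D Q (a + int t) b =
        monom (of_int (coeff (monom (int (p ^ Suc k choose Suc t)) t * Q (a + int t)) n)) n" for t
    proof (cases "t \<le> n")
      case le: True
      hence "nat (int n - int t) = n - t" by simp
      thus ?thesis
        using True le
        by (simp add: hom_def D acoef_def vpow_def coeff_monom_mult of_nat_poly smult_monom mult_monom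
            del: power_Suc)
    next
      case False
      thus ?thesis
        using True by (simp add: hom_def D coeff_monom_mult)
    qed
    thus ?thesis
      using True by (simp add: dmap_def hom_def D coeff_sum monom_sum del: power_Suc)
  qed
qed

text \<open>The image of a single row \<open>b\<close>. No upper bound on \<open>b - a\<close>
  appears because the binomial coefficient vanishes beyond it.\<close>

lemma sum_F_single:
  "(\<Sum>t<n. monom (int (n choose Suc t)) t * (if a + int t = b then P else 0)) =
    (if a \<le> b then monom (int (n choose Suc (nat (b - a)))) (nat (b - a)) * P else 0)"
proof (cases "a \<le> b")
  case True
  have "(\<Sum>t<n. monom (int (n choose Suc t)) t * (if a + int t = b then P else 0)) =
      (\<Sum>t<n. if t = nat (b - a)
        then monom (int (n choose Suc (nat (b - a)))) (nat (b - a)) * P else 0)"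
    using True by (intro sum.cong) auto
  thus ?thesis using True by (simp add: sum.delta binomial_eq_0)
qed auto

theorem theorem5p5:
  fixes p k :: nat
  assumes "prime p" and "k \<ge> 2"
  defines "g1 \<equiv> p - 1"
  shows "(\<exists>u. ku_unit p u \<and>
            eqv p (dmap p k (gen 1 (int (k * g1 + 1))))
                  (scal (u * of_nat p * vpow (k * g1)) (gen 1 1)))
       \<and> (\<exists>x u'. lower_filt p k x (int p) (int ((p * k + 1) * g1 + 1)) \<and> ku_unit p u' \<and>
            eqv p (dmap p k (addE (scal (of_nat p) (gen (int p) (int ((p * k + 1) * g1 + 1)))) x))
                  (scal (u' * vpow ((k * p + 2) * g1)) (gen 1 1)))"
proof -
  obtain V U H where "F p = of_nat p * V + T ^ (p - 1)" "poly V 0 = 1"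
    "H = of_nat p * U + T ^ (p * (p - 1))" "poly U 0 = 1" "F (p ^ 2) = F p * H"
    using F_square_prime[OF assms(1)] .
  then interpret F_square_factors p V U H
    using assms(1) by unfold_locales
  have p: "p \<ge> 2" by (rule p_ge_2)

  \<comment> \<open>Part (a): the image of \<open>[1, k g1 + 1]\<close>\<close>
  define u where "u = [:of_int ((-1) ^ k) :: rat:]"
  define D where "D = int (k * g1 + 2)"
  have "gen 1 (int (k * g1 + 1)) = hom D (\<lambda>a. if a = 1 then 1 else 0)"
    using hom_gen[of 1 "int (k * g1 + 1)" 1 0]
    by (simp add: D_def scal_def vpow_def add.commute monom_eq_1 flip: one_pCons cong: if_cong)
  moreover have "scal (u * of_nat p * vpow (k * g1)) (gen 1 1) =
      hom D (\<lambda>a. if a = 1 then monom ((-1) ^ k * int p) (k * g1) else 0)"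
    using hom_gen[of 1 1 "(-1) ^ k * int p" "k * g1"]
    by (simp add: u_def D_def of_nat_poly mult.commute)
  moreover have "eqv p (dmap p k (hom D (\<lambda>a. if a = 1 then 1 else 0)))
      (hom D (\<lambda>a. if a = 1 then monom ((-1) ^ k * int p) (k * g1) else 0))"
    unfolding dmap_hom sum_F_single
  proof (rule eqv_hom)
    fix a :: int assume a: "1 \<le> a" "a < D"
    have "nat (D - 1) = k * g1 + 1" by (simp add: D_def nat_eq_iff)
    moreover have "monom (int (p ^ Suc k)) 0 = of_nat p ^ Suc k"
      by (subst monom_of_nat) simp
    moreover have "monom ((-1) ^ k * int p) (k * g1) = (-1) ^ k * of_nat p * T ^ (k * (p - 1))"
      by (simp add: monom_sign_of_nat g1_def)
    ultimately show "(if a \<le> 1 then monom (int (p ^ Suc k choose Suc (nat (1 - a)))) (nat (1 - a)) * 1 else 0)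
        - (if a = 1 then monom ((-1) ^ k * int p) (k * g1) else 0) \<in> ideal2 p (nat (D - a))"
      using p_power_cong[of k] a ideal2I[of 0 p 0 _ 0]
      by (cases "a = 1") (simp_all add: g1_def del: power_Suc)
  qed
  moreover have "ku_unit p u"
    unfolding u_def by (rule ku_unit_of_int) (auto simp: minus_one_power_iff)
  ultimately have part_a: "\<exists>u. ku_unit p u \<and>
            eqv p (dmap p k (gen 1 (int (k * g1 + 1))))
                  (scal (u * of_nat p * vpow (k * g1)) (gen 1 1))"
    by auto

  \<comment> \<open>Part (b): the correction \<open>x\<close> and its image\<close>
  obtain c where c: "p ^ Suc k choose p = p ^ k * c" "\<not> p dvd c"
    using prime_power_choose_prime[OF assms(1)] .
  define J where "J = (p * k + 1) * g1 + 1"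
  have "J \<ge> 1" by (simp add: J_def)
  define E where "E = int (p + J)"
  define top where "top = U ^ Suc k * F p"
  \<comment> \<open>The factor \<open>c\<close> matches
    \<open>p ^ Suc k choose p = p ^ k * c\<close>, so that both contributions to row 1 share
    it.\<close>
  define bot where "bot = of_nat c * (T ^ (k * g1 * g1) * V ^ (k + 2) * H)"
  \<comment> \<open>The constant term of \<open>top\<close> is \<open>p\<close>, which is the
    prescribed leading term; the rest of row \<open>p\<close> has second index below
    \<open>J\<close>.\<close>
  define x where "x = hom E (\<lambda>a. (if a = 1 then bot else 0) + (if a = int p then top - of_nat p else 0))"
  define u' where "u' = [:of_int ((-1) ^ k * int c) :: rat:]"
  have "lower_filt p k x (int p) (int J)"
    unfolding lower_filt_def
  proof (intro conjI)
    show "valid p x" unfolding x_def by (rule valid_hom)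
    have "poly (top - of_nat p) 0 = 0"
      using p by (simp add: top_def U_0 V_0 F_p)
    hence top_0: "coeff (top - of_nat p) 0 = 0"
      by (simp only: poly_0_coeff_0)
    show "\<forall>(i, j)\<in>supp x. filt p k i j < filt p k (int p) (int J)"
    proof (clarify)
      fix i j assume ij: "(i, j) \<in> supp x"
      hence le: "1 \<le> i" "1 \<le> j" "i + j \<le> E" and i: "i = 1 \<or> i = int p"
        by (auto simp: supp_def x_def hom_def split: if_splits)
      show "filt p k i j < filt p k (int p) (int J)"
      proof (cases "i = int p")
        case True
        have "j \<noteq> int J"
          using ij True top_0 p by (auto simp: supp_def x_def hom_def E_def split: if_splits)
        hence "j < int J" using le True by (simp add: E_def)
        thus ?thesis using True by (simp add: filt_def mult_strict_right_mono add_pos_nonneg)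
      next
        case False
        hence "i = 1" using i by simp
        \<comment> \<open>Trading \<open>p - 1\<close> units of the first index for as many of the
          second lowers the filtration, as \<open>p ^ k < p ^ (k + 1)\<close>.\<close>
        hence "j \<le> int J + (int p - 1)" using le by (simp add: E_def)
        hence "filt p k i j \<le> (int p ^ (k + 1) + 1) + (int J + (int p - 1)) * (int p ^ k + 1)"
          using \<open>i = 1\<close> by (simp add: filt_def mult_right_mono)
        also have "\<dots> < filt p k (int p) (int J)"
        proof -
          have "int p ^ k < int p ^ (k + 1)"
            using p power_strict_increasing[of k "k + 1" "int p"] by linarith
          hence "(int p - 1) * (int p ^ k + 1) < (int p - 1) * (int p ^ (k + 1) + 1)"
            using p by (intro mult_strict_left_mono) linarith+
          thus ?thesis by (simp add: filt_def algebra_simps)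
        qed
        finally show ?thesis .
      qed
    qed
  qed
  moreover have "ku_unit p u'"
    unfolding u'_def
  proof (rule ku_unit_of_int)
    have "coprime c p"
      using prime_imp_coprime_nat[OF assms(1) c(2)] by (simp only: coprime_commute)
    thus "coprime ((-1) ^ k * int c) (int p)"
      by (simp add: minus_one_power_iff)
    show "(-1) ^ k * int c \<noteq> 0" using c(2) by (cases "c = 0") auto
  qed
  moreover have "addE (scal (of_nat p) (gen (int p) (int J))) x =
      hom E (\<lambda>a. (if a = 1 then bot else 0) + (if a = int p then top else 0))"
  proof -
    have "scal (of_nat p) (gen (int p) (int J)) = hom E (\<lambda>a. if a = int p then of_nat p else 0)"
      using hom_gen[of "int p" "int J" "int p" 0] p \<open>J \<ge> 1\<close>
      by (simp add: E_def of_nat_poly vpow_def monom_0 cong: if_cong)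
    thus ?thesis
      by (auto simp: x_def hom_add intro!: arg_cong[where f = "hom E"])
  qed
  moreover have "scal (u' * vpow ((k * p + 2) * g1)) (gen 1 1) =
      hom E (\<lambda>a. if a = 1 then monom ((-1) ^ k * int c) ((k * p + 2) * g1) else 0)"
  proof -
    have "1 + 1 + int ((k * p + 2) * g1) = E"
      using p by (simp add: E_def J_def g1_def algebra_simps)
    thus ?thesis
      using hom_gen[of 1 1 "(-1) ^ k * int c" "(k * p + 2) * g1"] by (simp add: u'_def)
  qed
  moreover have "eqv p (dmap p k (hom E (\<lambda>a. (if a = 1 then bot else 0) + (if a = int p then top else 0))))
      (hom E (\<lambda>a. if a = 1 then monom ((-1) ^ k * int c) ((k * p + 2) * g1) else 0))"
    unfolding dmap_hom distrib_left sum.distrib sum_F_single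
  proof (rule eqv_hom)
    fix a :: int assume a: "1 \<le> a" "a < E"
    let ?m = "nat (int p - a)"
    let ?row = "(if a \<le> 1 then monom (int (p ^ Suc k choose Suc (nat (1 - a)))) (nat (1 - a)) * bot else 0)
      + (if a \<le> int p then monom (int (p ^ Suc k choose Suc ?m)) ?m * top else 0)
      - (if a = 1 then monom ((-1) ^ k * int c) ((k * p + 2) * g1) else 0)"
    consider "a = 1" | "1 < a" "a \<le> int p" | "a > int p" using a by linarith
    thus "?row \<in> ideal2 p (nat (E - a))"
    proof cases
      case 1
      have E: "nat (E - 1) = (k * p + 2) * (p - 1) + 1"
        using p by (simp add: E_def J_def g1_def nat_eq_iff algebra_simps)
      have m: "?m = p - 1" "Suc ?m = p" using 1 p by simp_all
      have le: "a \<le> 1" "a \<le> int p" using 1 p by simp_all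
      have m1: "monom (int (p ^ Suc k choose Suc (nat (1 - a)))) (nat (1 - a)) = of_nat p ^ Suc k"
        using 1 by (subst monom_of_nat) simp
      have m2: "monom (int (p ^ Suc k choose Suc ?m)) ?m = of_nat c * of_nat p ^ k * T ^ (p - 1)"
        unfolding m(2) c(1) unfolding m(1) by (subst monom_of_nat) (simp add: mult_ac)
      have m3: "monom ((-1) ^ k * int c) ((k * p + 2) * g1) =
          of_nat c * ((-1) ^ k * T ^ ((k * p + 2) * (p - 1)))"
        by (subst monom_sign_of_nat) (simp add: g1_def)
      have distrib: "A * (C * (N * W * H)) + C * B * M * (X * Y) - C * Z = C * (B * M * X * Y + A * N * W * H - Z)"
        for A B C M N W X Y Z :: "int poly"
        by (simp add: algebra_simps)
      have "?row = of_nat p ^ Suc k * bot + of_nat c * of_nat p ^ k * T ^ (p - 1) * top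
          - of_nat c * ((-1) ^ k * T ^ ((k * p + 2) * (p - 1)))"
        unfolding if_P[OF le(1)] if_P[OF le(2)] if_P[OF 1] m1 m2 m3 by (rule refl)
      also have "\<dots> = of_nat c * (of_nat p ^ k * T ^ (p - 1) * U ^ Suc k * F p
          + of_nat p ^ Suc k * T ^ (k * (p - 1) * (p - 1)) * V ^ (k + 2) * H
          - (-1) ^ k * T ^ ((k * p + 2) * (p - 1)))"
        unfolding top_def bot_def g1_def by (rule distrib)
      also have "\<dots> \<in> ideal2 p (nat (E - a))"
        unfolding 1 E by (intro ideal2_mult row_one_cong)
      finally show ?thesis .
    next
      case 2
      \<comment> \<open>Here \<open>Suc ?m < p\<close>, so the full power \<open>p ^ Suc k\<close>
        is available to kill \<open>top\<close>.\<close>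
      have "p ^ Suc k dvd p ^ Suc k choose Suc ?m"
        using 2 p assms(1) by (intro prime_power_dvd_choose) auto
      then obtain d where d: "p ^ Suc k choose Suc ?m = p ^ Suc k * d"
        by (rule dvdE)
      have "1 * (p - 1) < p * (p - 1)"
        using p by (intro mult_strict_right_mono) auto
      \<comment> \<open>After removing \<open>p * k * (p - 1)\<close>, this says
        \<open>(p - 1) + 1 \<le> p * (p - 1)\<close>. The factor \<open>T ^ ?m\<close> then raises
        the order from \<open>J\<close> to \<open>E - a\<close>.\<close>
      hence le: "J \<le> Suc k * p * (p - 1)"
        by (simp only: J_def g1_def mult_Suc add_mult_distrib mult.commute[of p k])
      have "nat (E - a) \<le> ?m + J"
        using 2 by (simp add: E_def)
      hence "T ^ ?m * (of_nat p ^ Suc k * U ^ Suc k * F p) \<in> ideal2 p (nat (E - a))"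
        by (rule ideal2_T_mult[OF pU_power_F_in_ideal2[OF le]])
      moreover have "?row = of_nat d * (T ^ ?m * (of_nat p ^ Suc k * U ^ Suc k * F p))"
      proof -
        have "monom (int (p ^ Suc k choose Suc ?m)) ?m = of_nat d * of_nat p ^ Suc k * T ^ ?m"
          unfolding d by (subst monom_of_nat) (simp add: mult_ac)
        moreover have "\<not> a \<le> 1" "a \<noteq> 1" using 2 by simp_all
        ultimately show ?thesis using 2 by (simp only: top_def if_True if_False mult_ac add_0 diff_zero)
      qed
      ultimately show ?thesis
        by (simp only: ideal2_mult)
    next
      case 3
      thus ?thesis using a p ideal2I[of 0 p 0 _ 0] by simp
    qed
  qed
  ultimately have "lower_filt p k x (int p) (int J) \<and> ku_unit p u' \<and>
      eqv p (dmap p k (addE (scal (of_nat p) (gen (int p) (int J))) x))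
        (scal (u' * vpow ((k * p + 2) * g1)) (gen 1 1))"
    by (simp only: simp_thms)
  thus ?thesis
    using part_a unfolding J_def by blast
qed

end
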